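(* For any $0<\varepsilon<1$ and any (possibly partial) Boolean function $f:\mathcal{D}\subseteq\{0,1\}^n\to\{0,1\}$, $$\mathsf{Q}_0(f)\ge\Omega\left(\widetilde{\mathrm{osdeg}}_\varepsilon(f)\right),$$ where the implied constant may depend on $\varepsilon$ but not on $f$ or $n$.
   Context: A (possibly partial) Boolean function is a map $f:\mathcal{D}\to\{0,1\}$ with $\mathcal{D}\subseteq\{0,1\}^n$. $\mathsf{Q}_0(f)$ (zero-error quantum query complexity) is the minimum number of queries, in the standard quantum query model, of a quantum algorithm with outputs in $\{0,1,\bot\}$ that, on every $x\in\mathcal{D}$, outputs $\bot$ with probability at most $1/2$ and never outputs $1-f(x)$. For $\varepsilon_0,\varepsilon_1\ge0$, let $\Delta_{\varepsilon_0,\varepsilon_1,1}(f)$ be the minimum degree of a multilinear real polynomial $P$ such that $|P(x)-f(x)|\le\varepsilon_0$ for all $x\in f^{-1}(0)$, $|P(x)-f(x)|\le\varepsilon_1$ for all $x\in f^{-1}(1)$, and $P(x)\in[0,1]$ for all $x\in\{0,1\}^n$. The one-sided-error $\varepsilon$-approximate bounded-polynomial degree is $\widetilde{\mathrm{osdeg}}_\varepsilon(f)=\max\{\Delta_{\varepsilon,0,1}(f),\Delta_{0,\varepsilon,1}(f)\}$. *)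

theory Defs
  imports "Jordan_Normal_Form.Schur_Decomposition"
begin

text \<open>A partial Boolean function on \<open>n\<close> bits is a map \<open>f :: bool list \<rightharpoonup> bool\<close> with
  \<open>dom f \<subseteq> cube n\<close>; its domain plays the role of the promise set.\<close>

definition cube :: "nat \<Rightarrow> bool list set" where
  "cube n = {x. length x = n}"

text \<open>A multilinear real polynomial in \<open>n\<close> variables is given by its coefficients
  \<open>a S\<close> for \<open>S \<subseteq> {..<n}\<close>, where \<open>a S\<close> belongs to the monomial \<open>\<Prod>i\<in>S. y i\<close>;
  values of \<open>a\<close> on other sets are irrelevant. The zero polynomial has degree \<open>0\<close>.\<close>

definition ml_eval :: "nat \<Rightarrow> (nat set \<Rightarrow> real) \<Rightarrow> (nat \<Rightarrow> real) \<Rightarrow> real" where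
  "ml_eval n a y = (\<Sum>S\<in>Pow {..<n}. a S * (\<Prod>i\<in>S. y i))"

definition ml_degree :: "nat \<Rightarrow> (nat set \<Rightarrow> real) \<Rightarrow> nat" where
  "ml_degree n a = Max (insert 0 (card ` {S \<in> Pow {..<n}. a S \<noteq> 0}))"

definition ml_at :: "nat \<Rightarrow> (nat set \<Rightarrow> real) \<Rightarrow> bool list \<Rightarrow> real" where
  "ml_at n a x = ml_eval n a (\<lambda>i. of_bool (x ! i))"

definition bounded_approx ::
  "real \<Rightarrow> real \<Rightarrow> nat \<Rightarrow> (bool list \<rightharpoonup> bool) \<Rightarrow> (nat set \<Rightarrow> real) \<Rightarrow> bool" where
  "bounded_approx \<epsilon>\<^sub>0 \<epsilon>\<^sub>1 n f a \<longleftrightarrow>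
     (\<forall>x. f x = Some False \<longrightarrow> \<bar>ml_at n a x - 0\<bar> \<le> \<epsilon>\<^sub>0) \<and>
     (\<forall>x. f x = Some True \<longrightarrow> \<bar>ml_at n a x - 1\<bar> \<le> \<epsilon>\<^sub>1) \<and>
     (\<forall>x\<in>cube n. ml_at n a x \<in> {0..1})"

definition bounded_approx_degree :: "real \<Rightarrow> real \<Rightarrow> nat \<Rightarrow> (bool list \<rightharpoonup> bool) \<Rightarrow> nat" where
  "bounded_approx_degree \<epsilon>\<^sub>0 \<epsilon>\<^sub>1 n f =
     (LEAST d. \<exists>a. bounded_approx \<epsilon>\<^sub>0 \<epsilon>\<^sub>1 n f a \<and> ml_degree n a = d)"

definition osdeg :: "real \<Rightarrow> nat \<Rightarrow> (bool list \<rightharpoonup> bool) \<Rightarrow> nat" where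
  "osdeg \<epsilon> n f = max (bounded_approx_degree \<epsilon> 0 n f) (bounded_approx_degree 0 \<epsilon> n f)"

definition unitary_mat :: "nat \<Rightarrow> complex mat \<Rightarrow> bool" where
  "unitary_mat N U \<longleftrightarrow> U \<in> carrier_mat N N \<and> mat_adjoint U * U = 1\<^sub>m N"

text \<open>The basis states are \<open>|i, b, w\<rangle>\<close> with query index \<open>i \<le> n\<close>, answer bit \<open>b < 2\<close> and
  workspace content \<open>w < m\<close>, numbered as \<open>2 * ((n + 1) * w + i) + b\<close>. The query maps
  \<open>|i, b, w\<rangle>\<close> to \<open>|i, b \<oplus> x\<^sub>i, w\<rangle>\<close> for \<open>i < n\<close>; the extra index \<open>i = n\<close> is the customary
  null query, on which the query acts as the identity (it makes the space nontrivial
  also for \<open>n = 0\<close>).\<close>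

definition space_dim :: "nat \<Rightarrow> nat \<Rightarrow> nat" where
  "space_dim n m = 2 * ((n + 1) * m)"

definition query_perm :: "nat \<Rightarrow> bool list \<Rightarrow> nat \<Rightarrow> nat" where
  "query_perm n x k =
     (let i = (k div 2) mod (n + 1) in
      if i < n \<and> x ! i then (if even k then k + 1 else k - 1) else k)"

definition query_mat :: "nat \<Rightarrow> nat \<Rightarrow> bool list \<Rightarrow> complex mat" where
  "query_mat n m x =
     mat (space_dim n m) (space_dim n m) (\<lambda>(r, c). if r = query_perm n x c then 1 else 0)"

text \<open>The state \<open>U\<^sub>t O\<^sub>x U\<^sub>t\<^sub>-\<^sub>1 O\<^sub>x \<dots> O\<^sub>x U\<^sub>0 |0\<rangle>\<close> after \<open>t\<close> queries.\<close>

primrec query_state ::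
  "nat \<Rightarrow> nat \<Rightarrow> (nat \<Rightarrow> complex mat) \<Rightarrow> bool list \<Rightarrow> nat \<Rightarrow> complex vec" where
  "query_state n m U x 0 = U 0 *\<^sub>v unit_vec (space_dim n m) 0"
| "query_state n m U x (Suc t) = U (Suc t) *\<^sub>v (query_mat n m x *\<^sub>v query_state n m U x t)"

text \<open>The final state is measured in the computational basis, and outcome \<open>k\<close> is
  reported as \<open>out k\<close>, where \<open>None\<close> stands for \<open>\<bottom>\<close>.\<close>

definition output_prob ::
  "nat \<Rightarrow> nat \<Rightarrow> (nat \<Rightarrow> complex mat) \<Rightarrow> (nat \<Rightarrow> bool option) \<Rightarrow> nat \<Rightarrow> bool list
     \<Rightarrow> bool option \<Rightarrow> real" where
  "output_prob n m U out T x r =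
     (\<Sum>k | k < space_dim n m \<and> out k = r. (cmod (query_state n m U x T $ k))\<^sup>2)"

definition zero_error_algorithm ::
  "nat \<Rightarrow> (bool list \<rightharpoonup> bool) \<Rightarrow> nat \<Rightarrow> (nat \<Rightarrow> complex mat) \<Rightarrow> (nat \<Rightarrow> bool option)
     \<Rightarrow> nat \<Rightarrow> bool" where
  "zero_error_algorithm n f m U out T \<longleftrightarrow>
     m > 0 \<and> (\<forall>t\<le>T. unitary_mat (space_dim n m) (U t)) \<and>
     (\<forall>x b. f x = Some b \<longrightarrow>
        output_prob n m U out T x None \<le> 1/2 \<and>
        output_prob n m U out T x (Some (\<not> b)) = 0)"

definition Q0 :: "nat \<Rightarrow> (bool list \<rightharpoonup> bool) \<Rightarrow> nat" where
  "Q0 n f = (LEAST T. \<exists>m U out. zero_error_algorithm n f m U out T)"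

end

theory Submission
  imports Defs
begin

text \<open>The amplitudes after \<open>t\<close> queries are polynomials of degree at most \<open>t\<close> in the input bits, so
  a zero-error algorithm with \<open>T\<close> queries yields, for each bit \<open>b\<close>, the acceptance polynomial
  \<open>p\<^sub>b(x) = Pr[output b]\<close> of degree at most \<open>2T\<close>: it takes values in \<open>[0,1]\<close> on the whole cube, vanishes
  where \<open>f = 1 - b\<close> and is at least \<open>1/2\<close> where \<open>f = b\<close>. The polynomials \<open>1 - (1 - p\<^sub>1)\<^sup>k\<close> and
  \<open>(1 - p\<^sub>0)\<^sup>k\<close> with \<open>2\<^sup>-\<^sup>k \<le> \<epsilon>\<close> then witness both one-sided degrees. Since \<open>Q0\<close> is
  a \<open>LEAST\<close>, one also needs that some exact algorithm exists; reading all bits one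
  by one into the workspace, with suitable permutation matrices, is one.\<close>

section \<open>Functions on the cube of bounded degree\<close>

text \<open>Agreement is demanded on the cube only, where every bit equals its square; this is what
  closes the notion under products. An upper bound instead of the exact degree closes it under sums,
  where leading terms may cancel.\<close>

definition degree_le :: "nat \<Rightarrow> nat \<Rightarrow> (bool list \<Rightarrow> real) \<Rightarrow> bool" where
  "degree_le n d g \<longleftrightarrow> (\<exists>a. (\<forall>x\<in>cube n. ml_at n a x = g x) \<and> ml_degree n a \<le> d)"

lemma ml_degree_le_iff: "ml_degree n a \<le> d \<longleftrightarrow> (\<forall>S. S \<subseteq> {..<n} \<and> a S \<noteq> 0 \<longrightarrow> card S \<le> d)"
  unfolding ml_degree_def by (subst Max_le_iff) auto

lemma degree_le_mono: "degree_le n d g \<Longrightarrow> d \<le> e \<Longrightarrow> degree_le n e g"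
  unfolding degree_le_def by (meson order_trans)

lemma degree_le_cong:
  "degree_le n d g \<Longrightarrow> (\<And>x. x \<in> cube n \<Longrightarrow> g x = h x) \<Longrightarrow> degree_le n d h"
  unfolding degree_le_def by auto

lemma degree_le_monomial:
  assumes "S \<subseteq> {..<n}" "card S \<le> d"
  shows "degree_le n d (\<lambda>x. \<Prod>i\<in>S. of_bool (x ! i))"
proof -
  define a :: "nat set \<Rightarrow> real" where "a = (\<lambda>R. of_bool (R = S))"
  have "ml_at n a x = (\<Prod>i\<in>S. of_bool (x ! i))" for x
  proof -
    have "ml_at n a x
        = (\<Sum>R\<in>Pow {..<n}. if R = S then (\<Prod>i\<in>R. of_bool (x ! i)) else 0)"
      unfolding ml_at_def ml_eval_def a_def by (intro sum.cong) auto
    then show ?thesis using assms by simp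
  qed
  moreover have "ml_degree n a \<le> d"
    using assms unfolding ml_degree_le_iff a_def by auto
  ultimately show ?thesis unfolding degree_le_def by blast
qed

lemma degree_le_const: "degree_le n d (\<lambda>x. c)"
proof -
  define a :: "nat set \<Rightarrow> real" where "a = (\<lambda>R. if R = {} then c else 0)"
  have "ml_at n a x = c" for x
  proof -
    have "ml_at n a x = (\<Sum>R\<in>Pow {..<n}. if R = {} then c else 0)"
      unfolding ml_at_def ml_eval_def a_def by (intro sum.cong) auto
    then show ?thesis by simp
  qed
  moreover have "ml_degree n a \<le> d"
    unfolding ml_degree_le_iff a_def by auto
  ultimately show ?thesis unfolding degree_le_def by blast
qed

lemma degree_le_add:
  assumes "degree_le n d g" "degree_le n d h"
  shows "degree_le n d (\<lambda>x. g x + h x)"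
proof -
  from assms obtain a b where
    a: "\<forall>x\<in>cube n. ml_at n a x = g x" "ml_degree n a \<le> d" and
    b: "\<forall>x\<in>cube n. ml_at n b x = h x" "ml_degree n b \<le> d"
    unfolding degree_le_def by blast
  have "ml_at n (\<lambda>S. a S + b S) x = ml_at n a x + ml_at n b x" for x
    unfolding ml_at_def ml_eval_def by (simp add: distrib_right sum.distrib)
  moreover have "ml_degree n (\<lambda>S. a S + b S) \<le> d"
    using a(2) b(2) unfolding ml_degree_le_iff by (metis add.right_neutral)
  ultimately show ?thesis
    using a(1) b(1) unfolding degree_le_def by (intro exI[of _ "\<lambda>S. a S + b S"]) auto
qed

lemma degree_le_cmult:
  assumes "degree_le n d g"
  shows "degree_le n d (\<lambda>x. c * g x)"
proof -
  from assms obtain a where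
    a: "\<forall>x\<in>cube n. ml_at n a x = g x" "ml_degree n a \<le> d"
    unfolding degree_le_def by blast
  have "ml_at n (\<lambda>S. c * a S) x = c * ml_at n a x" for x
    unfolding ml_at_def ml_eval_def by (simp add: sum_distrib_left mult.assoc)
  moreover have "ml_degree n (\<lambda>S. c * a S) \<le> d"
    using a(2) unfolding ml_degree_le_iff by auto
  ultimately show ?thesis
    using a(1) unfolding degree_le_def by (intro exI[of _ "\<lambda>S. c * a S"]) auto
qed

lemma degree_le_diff:
  assumes "degree_le n d g" "degree_le n d h"
  shows "degree_le n d (\<lambda>x. g x - h x)"
  using degree_le_add[OF assms(1) degree_le_cmult[OF assms(2), of "-1"]] by simp

lemma degree_le_sum:
  assumes "\<And>i. i \<in> A \<Longrightarrow> degree_le n d (g i)"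
  shows "degree_le n d (\<lambda>x. \<Sum>i\<in>A. g i x)"
  using assms
  by (induction A rule: infinite_finite_induct) (auto intro: degree_le_const degree_le_add)

lemma degree_le_mult:
  assumes "degree_le n d g" "degree_le n e h"
  shows "degree_le n (d + e) (\<lambda>x. g x * h x)"
proof -
  let ?m = "\<lambda>S x. (\<Prod>i\<in>S. of_bool ((x::bool list) ! i)) :: real"
  from assms obtain a b where
    a: "\<forall>x\<in>cube n. ml_at n a x = g x" "ml_degree n a \<le> d" and
    b: "\<forall>x\<in>cube n. ml_at n b x = h x" "ml_degree n b \<le> e"
    unfolding degree_le_def by blast
  \<comment> \<open>On Boolean inputs the product of two monomials is the monomial of the union.\<close>
  have un: "?m S x * ?m R x = ?m (S \<union> R) x" if "S \<subseteq> {..<n}" "R \<subseteq> {..<n}" for S R x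
  proof -
    have m: "?m F x = of_bool (\<forall>i\<in>F. x ! i)" if "F \<subseteq> {..<n}" for F
      using finite_subset[OF that] by (induction F rule: finite_induct) auto
    show ?thesis using that by (subst (1 2 3) m) auto
  qed
  have "degree_le n (d + e) (\<lambda>x. \<Sum>S\<in>Pow {..<n}. \<Sum>R\<in>Pow {..<n}. a S * b R * ?m (S \<union> R) x)"
  proof (intro degree_le_sum)
    fix S R assume S: "S \<in> Pow {..<n}" and R: "R \<in> Pow {..<n}"
    show "degree_le n (d + e) (\<lambda>x. a S * b R * ?m (S \<union> R) x)"
    proof (cases "a S = 0 \<or> b R = 0")
      case True
      then show ?thesis by (auto intro: degree_le_const)
    next
      case False
      then have "card S \<le> d" "card R \<le> e"
        using a(2) b(2) S R unfolding ml_degree_le_iff by auto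
      then have "card (S \<union> R) \<le> d + e"
        using card_Un_le[of S R] by linarith
      then show ?thesis
        using S R by (intro degree_le_cmult degree_le_monomial) auto
    qed
  qed
  then show ?thesis
  proof (rule degree_le_cong)
    fix x assume x: "x \<in> cube n"
    have "g x * h x = ml_at n a x * ml_at n b x" using a b x by simp
    also have "\<dots> = (\<Sum>S\<in>Pow {..<n}. \<Sum>R\<in>Pow {..<n}. a S * b R * (?m S x * ?m R x))"
      unfolding ml_at_def ml_eval_def by (simp add: sum_product mult_ac)
    also have "\<dots> = (\<Sum>S\<in>Pow {..<n}. \<Sum>R\<in>Pow {..<n}. a S * b R * ?m (S \<union> R) x)"
      using un by (intro sum.cong refl) auto
    finally show "(\<Sum>S\<in>Pow {..<n}. \<Sum>R\<in>Pow {..<n}. a S * b R * ?m (S \<union> R) x) = g x * h x"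
      by simp
  qed
qed

lemma degree_le_power:
  assumes "degree_le n d g"
  shows "degree_le n (k * d) (\<lambda>x. g x ^ k)"
  by (induction k) (auto intro: degree_le_const degree_le_mult assms)

text \<open>Turns a function of bounded degree into a bound on the minimum. The errors are one-sided
  because the range [0,1] supplies the other side of each absolute value.\<close>

lemma bounded_approx_degree_le:
  assumes "degree_le n d g" "dom f \<subseteq> cube n"
    and "\<And>x. x \<in> cube n \<Longrightarrow> 0 \<le> g x \<and> g x \<le> 1"
    and "\<And>x. f x = Some False \<Longrightarrow> g x \<le> \<epsilon>\<^sub>0"
    and "\<And>x. f x = Some True \<Longrightarrow> 1 - g x \<le> \<epsilon>\<^sub>1"
  shows "bounded_approx_degree \<epsilon>\<^sub>0 \<epsilon>\<^sub>1 n f \<le> d"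
proof -
  from assms(1) obtain a where
    a: "\<forall>x\<in>cube n. ml_at n a x = g x" "ml_degree n a \<le> d"
    unfolding degree_le_def by blast
  have dom: "x \<in> cube n" if "f x = Some b" for x b
    using that assms(2) by auto
  have "bounded_approx \<epsilon>\<^sub>0 \<epsilon>\<^sub>1 n f a"
    unfolding bounded_approx_def
  proof (intro conjI allI impI ballI)
    show "\<bar>ml_at n a x - 0\<bar> \<le> \<epsilon>\<^sub>0" if "f x = Some False" for x
      using dom[OF that] assms(3,4)[of x] that a(1) by auto
    show "\<bar>ml_at n a x - 1\<bar> \<le> \<epsilon>\<^sub>1" if "f x = Some True" for x
      using dom[OF that] assms(3,5)[of x] that a(1) by auto
    show "ml_at n a x \<in> {0..1}" if "x \<in> cube n" for x
      using assms(3)[OF that] a(1) that by auto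
  qed
  then have "bounded_approx_degree \<epsilon>\<^sub>0 \<epsilon>\<^sub>1 n f \<le> ml_degree n a"
    unfolding bounded_approx_degree_def by (intro Least_le) auto
  with a(2) show ?thesis by simp
qed

section \<open>Unitary and permutation matrices\<close>

lemma adjoint_mult_index:
  assumes "U \<in> carrier_mat N N" "i < N" "j < N"
  shows "(mat_adjoint U * U) $$ (i, j) = (\<Sum>k<N. cnj (U $$ (k, i)) * U $$ (k, j))"
  using assms unfolding mat_adjoint_def
  by (auto simp: scalar_prod_def atLeast0LessThan intro!: sum.cong)

lemma unitary_mat_iff:
  "unitary_mat N U \<longleftrightarrow> U \<in> carrier_mat N N \<and>
     (\<forall>i<N. \<forall>j<N. (\<Sum>k<N. cnj (U $$ (k, i)) * U $$ (k, j)) = of_bool (i = j))"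
proof (cases "U \<in> carrier_mat N N")
  case True
  then have "dim_row (mat_adjoint U * U) = N" "dim_col (mat_adjoint U * U) = N"
    unfolding mat_adjoint_def by auto
  then have "mat_adjoint U * U = 1\<^sub>m N \<longleftrightarrow>
      (\<forall>i<N. \<forall>j<N. (mat_adjoint U * U) $$ (i, j) = of_bool (i = j))"
    by (auto simp: mat_eq_iff)
  with True show ?thesis
    unfolding unitary_mat_def by (auto simp: adjoint_mult_index)
qed (simp add: unitary_mat_def)

text \<open>Expanding the squared norm produces the inner products of the columns of
  \<open>U\<close>, and orthonormality leaves only the diagonal terms.\<close>

lemma unitary_mat_norm:
  assumes "unitary_mat N U" "v \<in> carrier_vec N"
  shows "(\<Sum>k<N. (cmod ((U *\<^sub>v v) $ k))\<^sup>2) = (\<Sum>k<N. (cmod (v $ k))\<^sup>2)"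
proof -
  have U: "U \<in> carrier_mat N N" and
    orth: "\<And>i j. i < N \<Longrightarrow> j < N \<Longrightarrow>
      (\<Sum>k<N. cnj (U $$ (k, i)) * U $$ (k, j)) = of_bool (i = j)"
    using assms(1) unfolding unitary_mat_iff by auto
  have idx: "(U *\<^sub>v v) $ k = (\<Sum>j<N. U $$ (k, j) * v $ j)" if "k < N" for k
    using that U assms(2) by (auto simp: scalar_prod_def atLeast0LessThan intro!: sum.cong)
  have "complex_of_real (\<Sum>k<N. (cmod ((U *\<^sub>v v) $ k))\<^sup>2)
      = (\<Sum>k<N. cnj ((U *\<^sub>v v) $ k) * (U *\<^sub>v v) $ k)"
    by (simp only: of_real_sum complex_norm_square mult.commute)
  also have "\<dots> = (\<Sum>k<N. \<Sum>i<N. \<Sum>j<N.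
      (cnj (v $ i) * v $ j) * (cnj (U $$ (k, i)) * U $$ (k, j)))"
  proof (intro sum.cong refl)
    fix k assume "k \<in> {..<N}"
    then have "cnj ((U *\<^sub>v v) $ k) * (U *\<^sub>v v) $ k
        = (\<Sum>i<N. cnj (U $$ (k, i)) * cnj (v $ i)) * (\<Sum>j<N. U $$ (k, j) * v $ j)"
      by (simp add: idx)
    then show "cnj ((U *\<^sub>v v) $ k) * (U *\<^sub>v v) $ k = (\<Sum>i<N. \<Sum>j<N.
        (cnj (v $ i) * v $ j) * (cnj (U $$ (k, i)) * U $$ (k, j)))"
      unfolding sum_product by (simp only: mult_ac)
  qed
  \<comment> \<open>With the row index \<open>k\<close> innermost, the inner sum is the inner
    product of columns \<open>i\<close> and \<open>j\<close>.\<close>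
  also have "\<dots> = (\<Sum>i<N. \<Sum>j<N. \<Sum>k<N.
      (cnj (v $ i) * v $ j) * (cnj (U $$ (k, i)) * U $$ (k, j)))"
    by (subst sum.swap) (intro sum.cong refl sum.swap)
  also have "\<dots> = (\<Sum>i<N. \<Sum>j<N. if i = j then cnj (v $ i) * v $ j else 0)"
    by (intro sum.cong refl) (simp add: sum_distrib_left[symmetric] orth)
  also have "\<dots> = (\<Sum>i<N. cnj (v $ i) * v $ i)"
    by simp
  also have "\<dots> = complex_of_real (\<Sum>k<N. (cmod (v $ k))\<^sup>2)"
    by (simp only: of_real_sum complex_norm_square mult.commute)
  finally show ?thesis by (simp only: of_real_eq_iff)
qed

definition perm_mat :: "nat \<Rightarrow> (nat \<Rightarrow> nat) \<Rightarrow> complex mat" where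
  "perm_mat N \<sigma> = mat N N (\<lambda>(r, c). if r = \<sigma> c then 1 else 0)"

lemma unitary_perm_mat:
  assumes "inj_on \<sigma> {..<N}" "\<sigma> ` {..<N} \<subseteq> {..<N}"
  shows "unitary_mat N (perm_mat N \<sigma>)"
  unfolding unitary_mat_iff
proof (intro conjI allI impI)
  show "perm_mat N \<sigma> \<in> carrier_mat N N" unfolding perm_mat_def by simp
next
  fix i j assume ij: "i < N" "j < N"
  \<comment> \<open>Column \<open>i\<close> has its only nonzero entry in row
    \<open>\<sigma> i\<close>.\<close>
  then have "(\<Sum>k<N. cnj (perm_mat N \<sigma> $$ (k, i)) * perm_mat N \<sigma> $$ (k, j))
      = (\<Sum>k<N. if k = \<sigma> i then of_bool (\<sigma> i = \<sigma> j) else 0)"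
    unfolding perm_mat_def by (intro sum.cong) auto
  also have "\<dots> = of_bool (i = j)"
    using ij assms by (auto dest: inj_onD)
  finally show "(\<Sum>k<N. cnj (perm_mat N \<sigma> $$ (k, i)) * perm_mat N \<sigma> $$ (k, j))
      = of_bool (i = j)" .
qed

lemma perm_mat_mult_unit_vec:
  assumes "a < N"
  shows "perm_mat N \<sigma> *\<^sub>v unit_vec N a = unit_vec N (\<sigma> a)"
proof (rule eq_vecI)
  fix r assume "r < dim_vec (unit_vec N (\<sigma> a) :: complex vec)"
  then have r: "r < N" by simp
  then have "(perm_mat N \<sigma> *\<^sub>v unit_vec N a) $ r
      = (\<Sum>c<N. (if r = \<sigma> c then 1 else 0) * (if c = a then 1 else 0))"
    unfolding perm_mat_def
    by (simp add: scalar_prod_def atLeast0LessThan unit_vec_def)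
  also have "\<dots> = (\<Sum>c<N. if c = a then (if r = \<sigma> a then 1 else 0) else 0)"
    by (intro sum.cong) auto
  also have "\<dots> = unit_vec N (\<sigma> a) $ r"
    using r assms by (simp add: unit_vec_def)
  finally show "(perm_mat N \<sigma> *\<^sub>v unit_vec N a) $ r = unit_vec N (\<sigma> a) $ r" .
qed (simp add: perm_mat_def)

text \<open>A partial injection between basis states extends to a permutation of the whole basis. A
  unitary can thus be specified just on the basis states that a computation reaches.\<close>

lemma ex_unitary_mapping:
  assumes "inj_on e P" "inj_on e' P" "e ` P \<subseteq> {..<N}" "e' ` P \<subseteq> {..<N}"
  shows "\<exists>U. unitary_mat N U \<and> (\<forall>p\<in>P. U *\<^sub>v unit_vec N (e p) = unit_vec N (e' p))"
proof -
  have fin: "finite (e ` P)" "finite (e' ` P)"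
    using assms(3,4) finite_subset by blast+
  \<comment> \<open>Both images have as many elements as \<open>P\<close>, so their complements can
    be matched by an arbitrary bijection \<open>g\<close>.\<close>
  have "card ({..<N} - e ` P) = card ({..<N} - e' ` P)"
    using assms fin by (simp add: card_Diff_subset card_image)
  then obtain g where g: "bij_betw g ({..<N} - e ` P) ({..<N} - e' ` P)"
    using finite_same_card_bij[of "{..<N} - e ` P" "{..<N} - e' ` P"] by auto
  define \<sigma> where "\<sigma> = (\<lambda>k. if k \<in> e ` P then e' (inv_into P e k) else g k)"
  have "bij_betw (e' \<circ> inv_into P e) (e ` P) (e' ` P)"
    using assms(1,2) by (intro bij_betw_trans[of _ _ P] bij_betw_inv_into inj_on_imp_bij_betw)
  then have "bij_betw \<sigma> (e ` P) (e' ` P)"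
    by (subst bij_betw_cong[of _ \<sigma> "e' \<circ> inv_into P e"]) (auto simp: \<sigma>_def)
  moreover have "bij_betw \<sigma> ({..<N} - e ` P) ({..<N} - e' ` P)"
    using g by (subst bij_betw_cong[of _ \<sigma> g]) (auto simp: \<sigma>_def)
  ultimately have "bij_betw \<sigma> (e ` P \<union> ({..<N} - e ` P)) (e' ` P \<union> ({..<N} - e' ` P))"
    by (rule bij_betw_combine) auto
  then have "bij_betw \<sigma> {..<N} {..<N}"
    using assms by (simp add: Un_absorb1)
  then have "unitary_mat N (perm_mat N \<sigma>)"
    by (intro unitary_perm_mat) (auto simp: bij_betw_def)
  moreover have "perm_mat N \<sigma> *\<^sub>v unit_vec N (e p) = unit_vec N (e' p)" if "p \<in> P" for p
  proof -
    have "e p < N" using that assms(3) by auto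
    moreover have "\<sigma> (e p) = e' p"
      using that assms(1) by (simp add: \<sigma>_def)
    ultimately show ?thesis by (simp add: perm_mat_mult_unit_vec)
  qed
  ultimately show ?thesis by blast
qed

section \<open>The polynomial method\<close>

lemma query_mat_eq: "query_mat n m x = perm_mat (space_dim n m) (query_perm n x)"
  unfolding query_mat_def perm_mat_def ..

text \<open>Indices \<open>2 * j\<close> and \<open>2 * j + 1\<close> differ only in the answer bit,
  and the dimension is even, so no such pair is cut off.\<close>

lemma flip_less_space_dim:
  assumes "k < space_dim n m"
  shows "(if even k then k + 1 else k - 1) < space_dim n m"
proof -
  have "(if even k then k + 1 else k - 1) < 2 * q" if "k < 2 * q" for q
    using that by presburger
  then show ?thesis using assms unfolding space_dim_def by blast
qed

lemma query_perm_less: "k < space_dim n m \<Longrightarrow> query_perm n x k < space_dim n m"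
  using flip_less_space_dim[of k n m] unfolding query_perm_def Let_def by presburger

lemma query_perm_div: "query_perm n x k div 2 = k div 2"
  unfolding query_perm_def Let_def by (auto elim!: oddE)

text \<open>The queried position depends on \<open>k div 2\<close> alone, which a flip preserves; a
  second query therefore tests the same bit and undoes the flip.\<close>

lemma query_perm_idem: "query_perm n x (query_perm n x k) = k"
proof -
  define flip where "flip k = (if even k then k + 1 else k - 1)" for k :: nat
  have flip: "flip (flip k) = k" unfolding flip_def by presburger
  have perm: "query_perm n x l =
      (if (l div 2) mod (n + 1) < n \<and> x ! ((l div 2) mod (n + 1)) then flip l else l)" for l
    unfolding query_perm_def flip_def Let_def ..
  show ?thesis
    using query_perm_div[of n x k] flip unfolding perm by (simp split: if_splits)
qed

lemma unitary_query_mat: "unitary_mat (space_dim n m) (query_mat n m x)"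
  unfolding query_mat_eq
  by (intro unitary_perm_mat)
    (auto intro: query_perm_less inj_on_inverseI[of _ "query_perm n x"] simp: query_perm_idem)

text \<open>The permutation is its own inverse, so applying its matrix reindexes the entries by the
  permutation itself.\<close>

lemma query_mat_mult_index:
  assumes "v \<in> carrier_vec (space_dim n m)" "r < space_dim n m"
  shows "(query_mat n m x *\<^sub>v v) $ r = v $ query_perm n x r"
proof -
  let ?N = "space_dim n m"
  have iff: "r = query_perm n x c \<longleftrightarrow> c = query_perm n x r" for c
    using query_perm_idem by metis
  have "(query_mat n m x *\<^sub>v v) $ r
      = (\<Sum>c<?N. (if c = query_perm n x r then 1 else 0) * v $ c)"
    unfolding query_mat_def using assms
    by (simp add: scalar_prod_def atLeast0LessThan iff)
  also have "\<dots> = (\<Sum>c<?N. if c = query_perm n x r then v $ c else 0)"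
    by (intro sum.cong) auto
  finally have "(query_mat n m x *\<^sub>v v) $ r
      = (\<Sum>c<?N. if c = query_perm n x r then v $ c else 0)" .
  then show ?thesis using query_perm_less[OF assms(2)] by simp
qed

lemma query_mat_carrier: "query_mat n m x \<in> carrier_mat (space_dim n m) (space_dim n m)"
  unfolding query_mat_def by simp

lemma query_state_carrier:
  assumes "\<forall>t\<le>T. unitary_mat (space_dim n m) (U t)" "t \<le> T"
  shows "query_state n m U x t \<in> carrier_vec (space_dim n m)"
  using assms(2)
proof (induction t)
  case 0
  then show ?case
    using assms(1) by (auto simp: unitary_mat_def intro: mult_mat_vec_carrier)
next
  case (Suc t)
  then show ?case
    using assms(1)
    by (auto simp: unitary_mat_def intro!: mult_mat_vec_carrier[OF _ mult_mat_vec_carrier]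
        query_mat_carrier)
qed

lemma query_state_norm:
  assumes "\<forall>t\<le>T. unitary_mat (space_dim n m) (U t)" "t \<le> T" "m > 0"
  shows "(\<Sum>k<space_dim n m. (cmod (query_state n m U x t $ k))\<^sup>2) = 1"
  using assms(2)
proof (induction t)
  case 0
  let ?N = "space_dim n m"
  have "(\<Sum>k<?N. (cmod (query_state n m U x 0 $ k))\<^sup>2)
      = (\<Sum>k<?N. (cmod ((unit_vec ?N 0 :: complex vec) $ k))\<^sup>2)"
    using assms(1) by (simp add: unitary_mat_norm)
  also have "\<dots> = (\<Sum>k<?N. if k = 0 then 1 else 0)"
    by (intro sum.cong) (auto simp: unit_vec_def)
  also have "\<dots> = 1"
    using assms(3) by (simp add: space_dim_def)
  finally show ?case .
next
  case (Suc t)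
  have c: "query_state n m U x t \<in> carrier_vec (space_dim n m)"
    using query_state_carrier[OF assms(1)] Suc.prems by simp
  then have "query_mat n m x *\<^sub>v query_state n m U x t \<in> carrier_vec (space_dim n m)"
    by (rule mult_mat_vec_carrier[OF query_mat_carrier])
  then show ?case
    using Suc assms(1) c by (simp add: unitary_mat_norm unitary_query_mat)
qed

section \<open>Degree of the amplitudes\<close>

definition complex_degree_le :: "nat \<Rightarrow> nat \<Rightarrow> (bool list \<Rightarrow> complex) \<Rightarrow> bool" where
  "complex_degree_le n d g \<longleftrightarrow>
     degree_le n d (\<lambda>x. Re (g x)) \<and> degree_le n d (\<lambda>x. Im (g x))"

text \<open>The entries of \<open>U\<close> do not depend on the input, so real and imaginary parts
  of the result are fixed real linear combinations of those of \<open>v x\<close>, which leaves the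
  degree unchanged.\<close>

lemma complex_degree_le_mat_mult:
  assumes "U \<in> carrier_mat N N" "\<And>x. v x \<in> carrier_vec N"
    and "\<And>k. k < N \<Longrightarrow> complex_degree_le n d (\<lambda>x. v x $ k)" "r < N"
  shows "complex_degree_le n d (\<lambda>x. (U *\<^sub>v v x) $ r)"
proof -
  have "(U *\<^sub>v v x) $ r = (\<Sum>j<N. U $$ (r, j) * v x $ j)" for x
    using assms(1,4) assms(2)[of x]
    by (auto simp: scalar_prod_def atLeast0LessThan intro!: sum.cong)
  then show ?thesis
    using assms(3) unfolding complex_degree_le_def
    by (auto intro!: degree_le_sum degree_le_add degree_le_diff degree_le_cmult)
qed

text \<open>A query selects between two fixed entries according to one bit \<open>y\<close> of the
  input. The selection is \<open>y * g x r' + (1 - y) * g x r\<close>, which costs one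
  degree.\<close>

lemma degree_le_query:
  assumes "\<And>k. k < space_dim n m \<Longrightarrow> degree_le n d (\<lambda>x. g x k)" "r < space_dim n m"
  shows "degree_le n (Suc d) (\<lambda>x. g x (query_perm n x r))"
proof -
  define i where "i = (r div 2) mod (n + 1)"
  define r' where "r' = (if even r then r + 1 else r - 1)"
  have perm: "query_perm n x r = (if i < n \<and> x ! i then r' else r)" for x
    unfolding query_perm_def i_def r'_def Let_def ..
  show ?thesis
  proof (cases "i < n")
    case True
    have r': "r' < space_dim n m"
      unfolding r'_def by (rule flip_less_space_dim[OF assms(2)])
    have bit: "degree_le n 1 (\<lambda>x. of_bool (x ! i))"
      using degree_le_monomial[of "{i}" n 1] True by simp
    have "degree_le n (1 + d) (\<lambda>x. of_bool (x ! i) * g x r' + (1 - of_bool (x ! i)) * g x r)"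
      by (intro degree_le_add degree_le_mult degree_le_diff bit degree_le_const assms r')
    then show ?thesis
      unfolding plus_1_eq_Suc by (rule degree_le_cong) (use True in \<open>auto simp: perm\<close>)
  next
    \<comment> \<open>This is the null query, which leaves every entry in place.\<close>
    case False
    then show ?thesis
      unfolding perm using degree_le_mono[OF assms(1)[OF assms(2)], of "Suc d"] by simp
  qed
qed

text \<open>The initial state is independent of the input, each query adds one to the degree, and
  each \<open>U t\<close> adds nothing.\<close>

lemma query_state_degree:
  assumes "\<forall>t\<le>T. unitary_mat (space_dim n m) (U t)" "t \<le> T" "k < space_dim n m"
  shows "complex_degree_le n t (\<lambda>x. query_state n m U x t $ k)"
  using assms(2,3)
proof (induction t arbitrary: k)
  case 0
  then show ?case
    by (simp add: complex_degree_le_def degree_le_const)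
next
  case (Suc t)
  let ?N = "space_dim n m"
  have c: "query_state n m U x t \<in> carrier_vec ?N" for x
    using query_state_carrier[OF assms(1)] Suc.prems by simp
  have q: "complex_degree_le n (Suc t) (\<lambda>x. (query_mat n m x *\<^sub>v query_state n m U x t) $ r)"
    if r: "r < ?N" for r
    using Suc.IH Suc.prems r
      degree_le_query[of n m t "\<lambda>x k. Re (query_state n m U x t $ k)" r]
      degree_le_query[of n m t "\<lambda>x k. Im (query_state n m U x t $ k)" r]
    unfolding complex_degree_le_def by (simp add: query_mat_mult_index[OF c])
  have "U (Suc t) \<in> carrier_mat ?N ?N"
    using assms(1) Suc.prems by (simp add: unitary_mat_def)
  then show ?case
    using complex_degree_le_mat_mult[OF _ mult_mat_vec_carrier[OF query_mat_carrier c] q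
        Suc.prems(2)] by simp
qed

section \<open>Output probabilities and the one-sided degrees\<close>

lemma output_prob_degree:
  assumes "\<forall>t\<le>T. unitary_mat (space_dim n m) (U t)"
  shows "degree_le n (2 * T) (\<lambda>x. output_prob n m U out T x r)"
proof -
  \<comment> \<open>The squared modulus is the sum of the squares of the real and imaginary parts,
    which doubles the degree.\<close>
  have "degree_le n (2 * T) (\<lambda>x. (cmod (query_state n m U x T $ k))\<^sup>2)"
    if "k < space_dim n m" for k
    using query_state_degree[OF assms order_refl that] unfolding cmod_power2 complex_degree_le_def
    by (auto intro: degree_le_add degree_le_power)
  then show ?thesis
    unfolding output_prob_def by (intro degree_le_sum) auto
qed

lemma output_prob_nonneg: "output_prob n m U out T x r \<ge> 0"
  unfolding output_prob_def by (intro sum_nonneg) auto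

text \<open>The three outcomes partition the basis and the state has norm 1. This holds for every
  \<open>x\<close>, also off the promise, so the acceptance polynomials stay in [0,1] on the whole
  cube.\<close>

lemma output_prob_total:
  assumes "\<forall>t\<le>T. unitary_mat (space_dim n m) (U t)" "m > 0"
  shows "output_prob n m U out T x None + output_prob n m U out T x (Some b)
       + output_prob n m U out T x (Some (\<not> b)) = 1"
proof -
  let ?N = "space_dim n m" and ?s = "\<lambda>k. (cmod (query_state n m U x T $ k))\<^sup>2"
  have "{k. k < ?N \<and> out k = None} \<union> {k. k < ?N \<and> out k = Some b}
      \<union> {k. k < ?N \<and> out k = Some (\<not> b)} = {..<?N}"
  proof -
    have "out k = None \<or> out k = Some b \<or> out k = Some (\<not> b)" for k
      by (cases "out k") auto
    then show ?thesis by auto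
  qed
  then have "1 = sum ?s ({k. k < ?N \<and> out k = None} \<union> {k. k < ?N \<and> out k = Some b}
      \<union> {k. k < ?N \<and> out k = Some (\<not> b)})"
    using query_state_norm[OF assms(1) order_refl assms(2)] by simp
  also have "\<dots> = output_prob n m U out T x None + output_prob n m U out T x (Some b)
       + output_prob n m U out T x (Some (\<not> b))"
    unfolding output_prob_def by (subst sum.union_disjoint; (subst sum.union_disjoint)?; force)
  finally show ?thesis by simp
qed

lemma osdeg_le_zero_error:
  assumes alg: "zero_error_algorithm n f m U out T" and dom: "dom f \<subseteq> cube n"
    and k: "(1/2) ^ k \<le> \<epsilon>"
  shows "osdeg \<epsilon> n f \<le> k * (2 * T)"
proof -
  have m: "m > 0" and U: "\<forall>t\<le>T. unitary_mat (space_dim n m) (U t)"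
    and f: "\<And>x b. f x = Some b \<Longrightarrow> output_prob n m U out T x None \<le> 1/2 \<and>
        output_prob n m U out T x (Some (\<not> b)) = 0"
    using alg unfolding zero_error_algorithm_def by auto
  define p where "p b x = output_prob n m U out T x (Some b)" for b x
  have p01: "0 \<le> p b x \<and> p b x \<le> 1" for b x
    using output_prob_total[OF U m, of out x b] output_prob_nonneg[of n m U out T x]
    unfolding p_def by (smt (verit))
  have zero: "p b x = 0" if "f x = Some (\<not> b)" for b x
    using f[OF that] unfolding p_def by simp
  \<comment> \<open>The wrong answer has probability 0 and \<bottom> at most 1/2, which leaves at
    least 1/2 for the right one.\<close>
  have half: "p b x \<ge> 1/2" if "f x = Some b" for b x
    using f[OF that] output_prob_total[OF U m, of out x b] unfolding p_def by simp
  have pow: "0 \<le> (1 - p b x) ^ k \<and> (1 - p b x) ^ k \<le> 1" for b x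
    using p01[of b x] by (auto intro: power_le_one)
  have small: "(1 - p b x) ^ k \<le> \<epsilon>" if "f x = Some b" for b x
    using power_mono[of "1 - p b x" "1/2" k] half[OF that] p01[of b x] k by linarith
  have deg: "degree_le n (k * (2 * T)) (\<lambda>x. (1 - p b x) ^ k)" for b
    unfolding p_def by (intro degree_le_power degree_le_diff degree_le_const output_prob_degree U)
  \<comment> \<open>The witness \<open>(1 - p False x) ^ k\<close> is exactly 1 on 1-inputs, where
    \<open>p False x = 0\<close>, and at most \<open>\<epsilon>\<close> on 0-inputs.\<close>
  have "bounded_approx_degree \<epsilon> 0 n f \<le> k * (2 * T)"
    by (rule bounded_approx_degree_le[OF deg[of False] dom])
      (use pow small zero[of _ False] in auto)
  \<comment> \<open>Here the witness \<open>1 - (1 - p True x) ^ k\<close> is exactly 0 on 0-inputs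
    and within \<open>\<epsilon>\<close> of 1 on 1-inputs.\<close>
  moreover have "bounded_approx_degree 0 \<epsilon> n f \<le> k * (2 * T)"
    by (rule bounded_approx_degree_le[OF degree_le_diff[OF degree_le_const deg[of True]] dom])
      (use pow small zero[of _ True] in auto)
  ultimately show ?thesis unfolding osdeg_def by simp
qed

section \<open>Existence of an exact algorithm\<close>

text \<open>The algorithm simulates a classical reader: after \<open>t\<close> queries the state is
  a single basis state holding the first \<open>t\<close> bits, query index \<open>t\<close> and
  answer bit 0. After \<open>n\<close> queries the whole input is known.\<close>

lemma ex_zero_error_algorithm:
  assumes "dom f \<subseteq> cube n"
  shows "\<exists>T m U out. zero_error_algorithm n f m U out T"
proof -
  define L where "L = {xs :: bool list. length xs \<le> n}"
  have finL: "finite L"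
    unfolding L_def using finite_lists_length_le[of "UNIV :: bool set" n] by simp
  define m where "m = card L"
  obtain c where c: "bij_betw c L {..<m}"
    using finL ex_bij_betw_finite_nat unfolding m_def atLeast0LessThan by blast
  have cinj: "c u = c v \<longleftrightarrow> u = v" if "u \<in> L" "v \<in> L" for u v
    using c that by (auto simp: bij_betw_def inj_on_def)
  have cm: "c u < m" if "u \<in> L" for u
    using c that by (auto simp: bij_betw_def)
  let ?N = "space_dim n m"
  \<comment> \<open>Basis state \<open>|t, b, w\<rangle>\<close>, where \<open>w\<close> encodes the prefix \<open>u\<close> that has been read.\<close>
  define ix where "ix u t b = 2 * ((n + 1) * c u + t) + of_bool b" for u t b
  have ix_div: "ix u t b div 2 = (n + 1) * c u + t" for u t b
    unfolding ix_def by (cases b) auto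
  \<comment> \<open>The case \<open>t = n\<close> is included: the final state carries the null
    query index.\<close>
  have ix_mod: "(ix u t b div 2) mod (n + 1) = t" if "t \<le> n" for u t b
    unfolding ix_div using that by (simp only: mod_mult_self4) simp
  have ix_code: "ix u t b div 2 div (n + 1) = c u" if "t \<le> n" for u t b
    unfolding ix_div using that by (subst div_mult_self4) auto
  have ix_even: "even (ix u t b) \<longleftrightarrow> \<not> b" for u t b
    unfolding ix_def by simp
  have ix_inj: "ix u t b = ix v t b' \<longleftrightarrow> u = v \<and> b = b'"
    if "u \<in> L" "v \<in> L" "t \<le> n" for u v t b b'
  proof
    assume eq: "ix u t b = ix v t b'"
    have "c u = c v"
      using ix_code[OF that(3), of u b] ix_code[OF that(3), of v b'] unfolding eq by (rule trans[OF sym])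
    moreover have "b = b'"
      using ix_even[of u t b] ix_even[of v t b'] unfolding eq by blast
    ultimately show "u = v \<and> b = b'" using cinj[OF that(1,2)] by blast
  qed simp
  have ix_less: "ix u t b < ?N" if "u \<in> L" "t \<le> n" for u t b
  proof -
    have "(n + 1) * c u + t < (n + 1) * (c u + 1)" using that by simp
    also have "\<dots> \<le> (n + 1) * m" using cm[OF that(1)] by (intro mult_le_mono2) simp
    finally show ?thesis unfolding ix_def space_dim_def by (cases b) auto
  qed
  have m: "m > 0"
    using cm[of "[]"] by (auto simp: L_def)
  \<comment> \<open>The step at 0 moves basis state 0 to the one encoding the empty prefix, as
    \<open>c []\<close> may be any label. Each later step appends the answer bit to the prefix,
    clears that bit and advances the query index.\<close>
  define good where "good t V \<longleftrightarrow> unitary_mat ?N V \<and>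
      (t = 0 \<longrightarrow> V *\<^sub>v unit_vec ?N 0 = unit_vec ?N (ix [] 0 False)) \<and>
      (\<forall>s u b. t = Suc s \<and> s < n \<and> length u = s \<longrightarrow>
        V *\<^sub>v unit_vec ?N (ix u s b) = unit_vec ?N (ix (u @ [b]) t False))" for t V
  have "\<exists>V. good t V" if "t \<le> n" for t
  proof (cases t)
    case 0
    show ?thesis
      using ex_unitary_mapping[of "\<lambda>_. 0" "{()}" "\<lambda>_. ix [] 0 False" ?N] m ix_less[of "[]" 0 False]
      by (auto simp: good_def 0 L_def space_dim_def)
  next
    case (Suc s)
    then have s: "s < n" using that by simp
    define P where "P = {u :: bool list. length u = s} \<times> (UNIV :: bool set)"
    define e where "e = (\<lambda>(u, b). ix u s b)"
    define e' where "e' = (\<lambda>(u, b). ix (u @ [b]) t False)"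
    \<comment> \<open>Clearing the answer bit is reversible because \<open>u @ [b]\<close> still
      determines both \<open>u\<close> and \<open>b\<close>.\<close>
    have e: "inj_on e P" and e': "inj_on e' P"
      using s Suc by (auto simp: inj_on_def P_def e_def e'_def ix_inj L_def)
    have "e ` P \<subseteq> {..<?N}" "e' ` P \<subseteq> {..<?N}"
      using s Suc by (auto simp: P_def e_def e'_def L_def intro!: ix_less)
    then obtain V where V: "unitary_mat ?N V"
      "\<forall>p\<in>P. V *\<^sub>v unit_vec ?N (e p) = unit_vec ?N (e' p)"
      using ex_unitary_mapping[OF e e'] by blast
    have "V *\<^sub>v unit_vec ?N (ix u s b) = unit_vec ?N (ix (u @ [b]) t False)"
      if "length u = s" for u b
      using V(2)[rule_format, of "(u, b)"] that by (simp add: P_def e_def e'_def)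
    then have "good t V" using V(1) Suc by (auto simp: good_def)
    then show ?thesis ..
  qed
  then obtain U where good: "\<And>t. t \<le> n \<Longrightarrow> good t (U t)" by metis
  have U: "\<And>t. t \<le> n \<Longrightarrow> unitary_mat ?N (U t)"
    "U 0 *\<^sub>v unit_vec ?N 0 = unit_vec ?N (ix [] 0 False)"
    "\<And>s u b. s < n \<Longrightarrow> length u = s \<Longrightarrow>
        U (Suc s) *\<^sub>v unit_vec ?N (ix u s b) = unit_vec ?N (ix (u @ [b]) (Suc s) False)"
    using good good[of 0] good[OF Suc_leI] unfolding good_def by simp_all
  have state: "query_state n m U x t = unit_vec ?N (ix (take t x) t False)"
    if "x \<in> cube n" "t \<le> n" for x t
    using that(2)
  proof (induction t)
    case 0
    then show ?case using U(2) by simp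
  next
    case (Suc t)
    have x: "length x = n" using that(1) by (simp add: cube_def)
    \<comment> \<open>The answer bit is 0 before the query and \<open>t < n\<close>, so the query
      writes \<open>x ! t\<close> into it.\<close>
    have q: "query_perm n x (ix (take t x) t False) = ix (take t x) t (x ! t)"
      unfolding query_perm_def ix_mod[OF Suc_leD[OF Suc.prems]] Let_def
      using Suc.prems by (auto simp: ix_def)
    have "query_mat n m x *\<^sub>v query_state n m U x t = unit_vec ?N (ix (take t x) t (x ! t))"
      using Suc ix_less[of "take t x" t False] x
      by (simp add: query_mat_eq perm_mat_mult_unit_vec L_def q)
    then show ?case
      using U(3)[of t "take t x" "x ! t"] x Suc.prems by (simp add: take_Suc_conv_app_nth)
  qed
  define out where "out k = f (inv_into L c (k div 2 div (n + 1)))" for k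
  have prob: "output_prob n m U out n x r = of_bool (r = f x)" if x: "x \<in> cube n" for x r
  proof -
    have xL: "x \<in> L" using x by (simp add: L_def cube_def)
    have o: "out (ix x n False) = f x"
      unfolding out_def ix_code[OF order_refl] using c xL by (simp add: bij_betw_def)
    have "query_state n m U x n = unit_vec ?N (ix x n False)"
      using state[OF x order_refl] x by (simp add: cube_def)
    then have "output_prob n m U out n x r
        = (\<Sum>k | k < ?N \<and> out k = r. if k = ix x n False then 1 else 0)"
      unfolding output_prob_def by (intro sum.cong) (auto simp: unit_vec_def)
    also have "\<dots> = of_bool (r = f x)"
      using ix_less[OF xL order_refl] o by auto
    finally show ?thesis .
  qed
  have "zero_error_algorithm n f m U out n"
    unfolding zero_error_algorithm_def
  proof (intro conjI allI impI m U(1))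
    fix x b assume b: "f x = Some b"
    then have "x \<in> cube n" using assms by auto
    then show "output_prob n m U out n x None \<le> 1/2"
      and "output_prob n m U out n x (Some (\<not> b)) = 0"
      using prob b by auto
  qed
  then show ?thesis by blast
qed

theorem theorem8:
  fixes \<epsilon> :: real
  assumes "0 < \<epsilon>" and "\<epsilon> < 1"
  shows "\<exists>c::real. c > 0 \<and>
    (\<forall>(n::nat) (f :: bool list \<rightharpoonup> bool). dom f \<subseteq> cube n \<longrightarrow>
       real (Q0 n f) \<ge> c * real (osdeg \<epsilon> n f))"
proof -
  \<comment> \<open>The exponent depends on \<open>\<epsilon>\<close> alone, so the constant
    \<open>1 / (2 * real k)\<close> is uniform in \<open>n\<close> and \<open>f\<close>.\<close>
  obtain k where k: "(1/2 :: real) ^ k < \<epsilon>"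
    using real_arch_pow_inv[OF assms(1), of "1/2"] by auto
  \<comment> \<open>For \<open>k = 0\<close> the power would be 1, contradicting
    \<open>\<epsilon> < 1\<close>.\<close>
  then have k0: "k > 0"
    using assms(2) by (cases k) auto
  have "1 / (2 * real k) * real (osdeg \<epsilon> n f) \<le> real (Q0 n f)" if "dom f \<subseteq> cube n" for n f
  proof -
    \<comment> \<open>Since some exact algorithm exists, the minimum is attained.\<close>
    have "\<exists>m U out. zero_error_algorithm n f m U out (Q0 n f)"
      unfolding Q0_def by (rule LeastI_ex) (rule ex_zero_error_algorithm[OF that])
    then have "osdeg \<epsilon> n f \<le> k * (2 * Q0 n f)"
      using osdeg_le_zero_error that k by (meson less_imp_le)
    then have "real (osdeg \<epsilon> n f) \<le> real k * (2 * real (Q0 n f))"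
      by (metis of_nat_le_iff of_nat_mult of_nat_numeral)
    then show ?thesis using k0 by (simp add: field_simps)
  qed
  moreover have "1 / (2 * real k) > 0" using k0 by simp
  ultimately show ?thesis by blast
qed

end
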